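(* Let $p>3$ be a prime and let $m$ be a positive integer not divisible by $p$. Then $$\sum_{k=0}^{p-1}(-1)^{km}\binom{p/m-1}{k}^m\equiv 0\pmod{p^4}.$$ In particular, $$\sum_{k=0}^{p-1}\binom{1/(p-1)}{k}^{p-1}\equiv 0\pmod{p^4}.$$
   Context: For a rational number $x$ and a nonnegative integer $k$, $\binom{x}{k}=\frac{x(x-1)\cdots(x-k+1)}{k!}$ (with $\binom{x}{0}=1$). For rationals $a,b$ whose denominators are prime to $p$, $a\equiv b \pmod{p^r}$ means that $(a-b)/p^r$ is a rational number whose denominator is prime to $p$. *)

theory Defs
  imports Complex_Main "HOL-Computational_Algebra.Primes"
begin

(* quotient_of returns numerator and positive denominator in lowest terms. *)
definition p_integral :: "nat \<Rightarrow> rat \<Rightarrow> bool"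
  where "p_integral p x \<longleftrightarrow> coprime (snd (quotient_of x)) (int p)"

(* The first two conjuncts record that the congruence is only meant for p-integral a and b. *)
definition rat_cong :: "nat \<Rightarrow> nat \<Rightarrow> rat \<Rightarrow> rat \<Rightarrow> bool"
  where "rat_cong p r a b \<longleftrightarrow>
    p_integral p a \<and> p_integral p b \<and> p_integral p ((a - b) / of_nat p ^ r)"

end

theory Submission
  imports Defs
begin

text \<open>
  With \<open>n = 1/m\<close>, the \<open>k\<close>-th summand is the product of \<open>(1 - pn/j) ^ m\<close> over \<open>1 \<le> j \<le> k\<close>. Modulo \<open>p ^ 4\<close>
  it is a polynomial in \<open>n\<close> whose coefficients involve the power sums \<open>H\<^sub>s(k)\<close> of \<open>1/j\<close>.
  Summed over \<open>k\<close>, the coefficients of \<open>n\<close> and \<open>n ^ 2\<close> vanish modulo \<open>p ^ 4\<close>: this follows from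
  Wolstenholme's congruences, and for the term with \<open>H\<^sub>1(k) H\<^sub>2(k)\<close> from its antisymmetry modulo \<open>p\<close>
  under \<open>k \<mapsto> p - 1 - k\<close>. So the sum does not depend on \<open>m\<close> modulo \<open>p ^ 4\<close>, and for \<open>m = 1\<close> it is
  the alternating sum of the binomial coefficients of \<open>p - 1\<close>, which is zero. The second claim
  is the case \<open>m = p - 1\<close>.
\<close>

section \<open>The ring of \<open>p\<close>-integral rationals\<close>

lemma p_integral_iff:
  "p_integral p x \<longleftrightarrow> (\<exists>a b. x = of_int a / of_int b \<and> coprime b (int p) \<and> b \<noteq> 0)"
proof
  assume "p_integral p x"
  then show "\<exists>a b. x = of_int a / of_int b \<and> coprime b (int p) \<and> b \<noteq> 0"
    unfolding p_integral_def
    by (metis quotient_of_div prod.collapse quotient_of_denom_pos' less_irrefl)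
next
  assume "\<exists>a b. x = of_int a / of_int b \<and> coprime b (int p) \<and> b \<noteq> 0"
  then obtain a b where x: "x = of_int a / of_int b" and b: "coprime b (int p)" "b \<noteq> 0" by blast
  obtain c d where q: "quotient_of x = (c, d)" by fastforce
  have d: "d > 0" and cd: "coprime c d" and xd: "x = of_int c / of_int d"
    using q quotient_of_denom_pos quotient_of_coprime quotient_of_div by blast+
  have "(of_int (a * d) :: rat) = of_int (c * b)"
    using x xd b d by (simp add: field_simps)
  then have "a * d = c * b" by (simp only: of_int_eq_iff)
  \<comment> \<open>The reduced denominator divides every other denominator of the same number, so
    coprimality to \<open>p\<close> may be tested on any representation.\<close>
  then have "d dvd c * b" by (metis dvd_triv_right)
  then have "d dvd b" using cd by (simp add: coprime_commute coprime_dvd_mult_right_iff)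
  then show "p_integral p x"
    using b q unfolding p_integral_def by (auto intro: coprime_divisors[of d b "int p" "int p"])
qed

lemma p_integral_of_int [simp]: "p_integral p (of_int a)"
  unfolding p_integral_iff by (rule exI[of _ a], rule exI[of _ 1]) auto

lemma p_integral_of_nat [simp]: "p_integral p (of_nat a)"
  using p_integral_of_int[of p "int a"] by simp

lemma p_integral_numeral [simp]:
  "p_integral p 0" "p_integral p 1" "p_integral p (numeral w)"
  using p_integral_of_nat[of p 0] p_integral_of_nat[of p 1] p_integral_of_nat[of p "numeral w"]
  by simp_all

lemma p_integral_add:
  assumes "p_integral p x" "p_integral p y"
  shows "p_integral p (x + y)"
proof -
  obtain a b c d where "x = of_int a / of_int b" "coprime b (int p)" "b \<noteq> 0"
    "y = of_int c / of_int d" "coprime d (int p)" "d \<noteq> 0"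
    using assms unfolding p_integral_iff by blast
  then have "x + y = of_int (a * d + c * b) / of_int (b * d)" "coprime (b * d) (int p)" "b * d \<noteq> 0"
    by (simp_all add: field_simps)
  then show ?thesis unfolding p_integral_iff by blast
qed

lemma p_integral_mult:
  assumes "p_integral p x" "p_integral p y"
  shows "p_integral p (x * y)"
proof -
  obtain a b c d where "x = of_int a / of_int b" "coprime b (int p)" "b \<noteq> 0"
    "y = of_int c / of_int d" "coprime d (int p)" "d \<noteq> 0"
    using assms unfolding p_integral_iff by blast
  then have "x * y = of_int (a * c) / of_int (b * d)" "coprime (b * d) (int p)" "b * d \<noteq> 0"
    by simp_all
  then show ?thesis unfolding p_integral_iff by blast
qed

lemma p_integral_uminus: "p_integral p x \<Longrightarrow> p_integral p (- x)"
  using p_integral_mult[OF p_integral_of_int[of p "- 1"], of x] by simp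

lemma p_integral_diff: "p_integral p x \<Longrightarrow> p_integral p y \<Longrightarrow> p_integral p (x - y)"
  using p_integral_add[of p x "- y"] p_integral_uminus by simp

lemma p_integral_power: "p_integral p x \<Longrightarrow> p_integral p (x ^ k)"
  by (induction k) (auto intro: p_integral_mult)

lemma p_integral_sum: "(\<And>i. i \<in> A \<Longrightarrow> p_integral p (f i)) \<Longrightarrow> p_integral p (sum f A)"
  by (induction A rule: infinite_finite_induct) (auto intro: p_integral_add)

lemma p_integral_inverse_of_nat:
  assumes "prime p" "\<not> p dvd m"
  shows "p_integral p (1 / of_nat m)"
proof -
  have "coprime p m" using assms by (rule prime_imp_coprime)
  moreover have "m \<noteq> 0" using assms(2) by (metis dvd_0_right)
  ultimately have "coprime m p" "m \<noteq> 0" by (simp_all add: coprime_commute)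
  then show ?thesis unfolding p_integral_iff
    by (intro exI[of _ 1] exI[of _ "int m"]) auto
qed

lemmas p_integral_intros = p_integral_add p_integral_mult p_integral_uminus p_integral_diff
  p_integral_power p_integral_sum

section \<open>Congruence to 0 modulo \<open>p ^ r\<close> as membership in the ideal generated by
  \<open>p ^ r\<close>\<close>

definition p_pow_ideal :: "nat \<Rightarrow> nat \<Rightarrow> rat set"
  where "p_pow_ideal p r = {of_nat p ^ r * y | y. p_integral p y}"

lemma p_pow_idealI: "p_integral p y \<Longrightarrow> x = of_nat p ^ r * y \<Longrightarrow> x \<in> p_pow_ideal p r"
  unfolding p_pow_ideal_def by blast

lemma p_pow_idealE:
  assumes "x \<in> p_pow_ideal p r"
  obtains y where "p_integral p y" "x = of_nat p ^ r * y"
  using assms unfolding p_pow_ideal_def by blast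

lemma p_pow_ideal_zero [simp]: "0 \<in> p_pow_ideal p r"
  by (rule p_pow_idealI[of _ 0]) auto

lemma p_pow_ideal_add: "x \<in> p_pow_ideal p r \<Longrightarrow> y \<in> p_pow_ideal p r \<Longrightarrow> x + y \<in> p_pow_ideal p r"
  by (elim p_pow_idealE, rule p_pow_idealI, erule (1) p_integral_add) (simp only: distrib_left)

lemma p_pow_ideal_diff: "x \<in> p_pow_ideal p r \<Longrightarrow> y \<in> p_pow_ideal p r \<Longrightarrow> x - y \<in> p_pow_ideal p r"
  by (elim p_pow_idealE, rule p_pow_idealI, erule (1) p_integral_diff) (simp only: right_diff_distrib)

lemma p_pow_ideal_sum:
  "(\<And>i. i \<in> A \<Longrightarrow> f i \<in> p_pow_ideal p r) \<Longrightarrow> sum f A \<in> p_pow_ideal p r"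
  by (induction A rule: infinite_finite_induct) (auto intro: p_pow_ideal_add)

lemma p_pow_ideal_mult_left:
  assumes "p_integral p c" "x \<in> p_pow_ideal p r"
  shows "c * x \<in> p_pow_ideal p r"
proof -
  obtain y where "p_integral p y" "x = of_nat p ^ r * y" using assms(2) by (rule p_pow_idealE)
  then show ?thesis using assms(1)
    by (intro p_pow_idealI[of _ "c * y"]) (auto intro: p_integral_mult)
qed

lemma p_pow_ideal_power_mult:
  assumes "x \<in> p_pow_ideal p r"
  shows "of_nat p ^ s * x \<in> p_pow_ideal p (s + r)"
proof -
  obtain y where "p_integral p y" "x = of_nat p ^ r * y" using assms by (rule p_pow_idealE)
  then show ?thesis by (intro p_pow_idealI[of _ y]) (auto simp: power_add)
qed

text \<open>An integer prime to \<open>p\<close> is a unit among the \<open>p\<close>-integral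
  rationals. This removes the factors 2 and 3 that the symmetry arguments below introduce.\<close>

lemma p_pow_ideal_cancel:
  assumes "prime p" "\<not> p dvd m" "of_nat m * x \<in> p_pow_ideal p r"
  shows "x \<in> p_pow_ideal p r"
proof -
  have "m \<noteq> 0" using assms(2) by (metis dvd_0_right)
  then show ?thesis
    using p_pow_ideal_mult_left[OF p_integral_inverse_of_nat[OF assms(1,2)] assms(3)] by simp
qed

section \<open>Expansion of the summands modulo \<open>p ^ 4\<close>\<close>

lemma binomial_expansion_4:
  assumes "p_integral p x" "p_integral p (1/2)" "p_integral p (1/3)"
  shows "\<exists>q. p_integral p q \<and> (1 - x) ^ m = 1 - of_nat m * x + of_nat m * (of_nat m - 1) / 2 * x^2
     - of_nat m * (of_nat m - 1) * (of_nat m - 2) / 6 * x^3 + x^4 * q"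
proof (induction m)
  case 0
  show ?case by (rule exI[of _ 0]) simp
next
  case (Suc m)
  define s :: rat where "s = of_nat m"
  obtain q where q: "p_integral p q"
    and e: "(1 - x) ^ m = 1 - s * x + s * (s - 1) / 2 * x^2 - s * (s - 1) * (s - 2) / 6 * x^3 + x^4 * q"
    using Suc unfolding s_def by blast
  \<comment> \<open>The new quotient collects the product of the old cubic term with
    \<open>- x\<close> and the old remainder times \<open>1 - x\<close>. The denominator 6 is split
    into 2 and 3 to match the integrality assumptions.\<close>
  have "(1 - x) ^ Suc m = 1 - (1 + s) * x + (1 + s) * s / 2 * x^2 - (1 + s) * s * (s - 1) / 6 * x^3
      + x^4 * (s * (s - 1) * (s - 2) * (1/2) * (1/3) + q * (1 - x))"
    unfolding power_Suc e by (simp add: field_simps power2_eq_square power3_eq_cube power4_eq_xxxx)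
  moreover have "p_integral p (s * (s - 1) * (s - 2) * (1/2) * (1/3) + q * (1 - x))"
    using q assms unfolding s_def by (intro p_integral_intros) auto
  moreover have "of_nat (Suc m) = 1 + s" "(1 + s) - 1 = s" "(1 + s) - 2 = s - 1" by (simp_all add: s_def)
  ultimately show ?case by metis
qed

definition hsum :: "nat \<Rightarrow> nat \<Rightarrow> rat"
  where "hsum s k = (\<Sum>j=1..k. (1 / of_nat j) ^ s)"

lemma hsum_0 [simp]: "hsum s 0 = 0" by (simp add: hsum_def)

lemma hsum_Suc: "hsum s (Suc k) = hsum s k + (1 / of_nat (Suc k)) ^ s"
  by (simp add: hsum_def)

text \<open>Truncation at \<open>p ^ 4\<close> of \<open>exp (- p H\<^sub>1 - p\<^sup>2 n H\<^sub>2 / 2 - p\<^sup>3 n\<^sup>2 H\<^sub>3 / 3)\<close>, which is what taking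
  logarithms of the product of the \<open>(1 - pn/j) ^ m\<close> gives when \<open>m n = 1\<close>.\<close>

definition expansion :: "nat \<Rightarrow> rat \<Rightarrow> nat \<Rightarrow> rat"
  where "expansion p n k = 1 - of_nat p * hsum 1 k
    + of_nat p ^ 2 * (((hsum 1 k)^2 - n * hsum 2 k) / 2)
    - of_nat p ^ 3 * ((hsum 1 k)^3 / 6 - n * hsum 1 k * hsum 2 k / 2 + n^2 * hsum 3 k / 3)"

text \<open>Consecutive binomial coefficients have ratio (x - 1 - k)/(k + 1) = -(1 - x/(k + 1)), and
  the sign factor absorbs the minus. This drives the induction on \<open>k\<close> that builds the
  product.\<close>

lemma gbinomial_power_Suc:
  fixes x :: rat
  shows "(-1) ^ (Suc k * m) * ((x - 1) gchoose Suc k) ^ m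
    = ((-1) ^ (k * m) * ((x - 1) gchoose k) ^ m) * (1 - x / of_nat (Suc k)) ^ m"
proof -
  have "(x - 1) gchoose Suc k = ((x - 1) gchoose k) * (x - 1 - of_nat k) / of_nat (Suc k)"
    using gbinomial_mult_1[of "x - 1" k] by (simp add: field_simps del: of_nat_Suc)
  also have "\<dots> = - (((x - 1) gchoose k) * (1 - x / of_nat (Suc k)))"
    by (simp add: field_simps)
  finally have "(-1) ^ Suc k * ((x - 1) gchoose Suc k)
      = ((-1) ^ k * ((x - 1) gchoose k)) * (1 - x / of_nat (Suc k))" by simp
  then show ?thesis unfolding power_mult power_mult_distrib[symmetric] by simp
qed

context
  fixes p :: nat
  assumes p: "prime p" and p3: "p > 3"
begin

lemma p_integral_reciprocal: "0 < j \<Longrightarrow> j < p \<Longrightarrow> p_integral p (1 / of_nat j)"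
  using p by (intro p_integral_inverse_of_nat) (auto dest: dvd_imp_le)

lemma p_integral_half: "p_integral p (1/2)" and p_integral_third: "p_integral p (1/3)"
  using p_integral_reciprocal[of 2] p_integral_reciprocal[of 3] p3 by auto

lemma p_integral_hsum: "k < p \<Longrightarrow> p_integral p (hsum s k)"
  unfolding hsum_def by (intro p_integral_intros p_integral_reciprocal) auto

text \<open>Induction on \<open>k\<close>: passing to \<open>Suc k\<close> multiplies by one more
  factor (1 - pn/(k + 1))^m. As k + 1 < p, its reciprocal is \<open>p\<close>-integral, and so are
  all the remainders.\<close>

lemma term_expansion:
  assumes m: "m > 0" "\<not> p dvd m" and k: "k < p"
  shows "\<exists>q. p_integral p q \<and> (-1) ^ (k * m) * ((of_nat p / of_nat m - 1 :: rat) gchoose k) ^ m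
     = expansion p (1 / of_nat m) k + of_nat p ^ 4 * q"
  using k
proof (induction k)
  case 0
  show ?case by (rule exI[of _ 0]) (simp add: expansion_def)
next
  case (Suc k)
  define n :: rat where "n = 1 / of_nat m"
  define d :: rat where "d = 1 / of_nat (Suc k)"
  define P :: rat where "P = of_nat p"
  define a b c where "a = hsum 1 k" and "b = (a^2 - n * hsum 2 k) / 2"
    and "c = a^3 / 6 - n * a * hsum 2 k / 2 + n^2 * hsum 3 k / 3"
  define e f where "e = (1 - n) / 2 * d^2" and "f = (1 - n) * (1 - 2 * n) / 6 * d^3"
  have n: "p_integral p n" unfolding n_def using p m p_integral_inverse_of_nat by blast
  have d: "p_integral p d" unfolding d_def using Suc.prems by (intro p_integral_reciprocal) auto
  have P: "p_integral p P" by (simp add: P_def)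
  have h: "p_integral p (hsum s k)" for s using Suc.prems p_integral_hsum by simp
  have a: "p_integral p a" unfolding a_def by (rule h)
  have "b = (a^2 - n * hsum 2 k) * (1/2)"
    and "c = a^3 * (1/2) * (1/3) - n * a * hsum 2 k * (1/2) + n^2 * hsum 3 k * (1/3)"
    and "e = (1 - n) * (1/2) * d^2" and "f = (1 - n) * (1 - 2 * n) * (1/2) * (1/3) * d^3"
    unfolding b_def c_def e_def f_def by simp_all
  then have bcef: "p_integral p b" "p_integral p c" "p_integral p e" "p_integral p f"
    by (simp_all only:) (intro p_integral_intros n d a h p_integral_half p_integral_third p_integral_numeral)+
  obtain q where q: "p_integral p q" and eq:
    "(-1) ^ (k * m) * ((of_nat p / of_nat m - 1 :: rat) gchoose k) ^ m = expansion p n k + P^4 * q"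
    using Suc unfolding n_def P_def by auto
  have x: "p_integral p (P * n * d)" using P n d by (intro p_integral_intros)
  obtain u where u: "p_integral p u" and ueq: "(1 - P * n * d) ^ m
     = 1 - of_nat m * (P * n * d) + of_nat m * (of_nat m - 1) / 2 * (P * n * d)^2
     - of_nat m * (of_nat m - 1) * (of_nat m - 2) / 6 * (P * n * d)^3 + (P * n * d)^4 * u"
    using binomial_expansion_4[OF x p_integral_half p_integral_third] by blast
  \<comment> \<open>Each \<open>m\<close> is absorbed by one factor \<open>n\<close>, so the
    binomial coefficients in \<open>m\<close> become polynomials in \<open>n\<close>.\<close>
  have mn: "of_nat m * n = 1" using m by (simp add: n_def)
  have t1: "of_nat m * (P * n * d) = P * d" using mn by (metis mult.assoc mult.commute mult_1)
  have t2: "of_nat m * (of_nat m - 1) / 2 * (P * n * d)^2 = P^2 * e"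
  proof -
    have "of_nat m * (of_nat m - 1) / 2 * (P * n * d)^2
        = (of_nat m * n) * (of_nat m * n - n) / 2 * P^2 * d^2"
      by (simp add: power2_eq_square algebra_simps)
    then show ?thesis unfolding mn e_def by simp
  qed
  have t3: "of_nat m * (of_nat m - 1) * (of_nat m - 2) / 6 * (P * n * d)^3 = P^3 * f"
  proof -
    have "of_nat m * (of_nat m - 1) * (of_nat m - 2) / 6 * (P * n * d)^3
        = (of_nat m * n) * (of_nat m * n - n) * (of_nat m * n - 2 * n) / 6 * P^3 * d^3"
      by (simp add: power3_eq_cube algebra_simps)
    then show ?thesis unfolding mn f_def by simp
  qed
  define E where "E = 1 - P * d + P^2 * e - P^3 * f"
  define v where "v = (n * d)^4 * u"
  have v: "p_integral p v" unfolding v_def using n d u by (intro p_integral_intros)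
  have Eeq: "(1 - P * n * d) ^ m = E + P^4 * v"
    unfolding ueq t1 t2 t3 E_def v_def by (simp add: power_mult_distrib)
  have F: "expansion p n k = 1 - P * a + P^2 * b - P^3 * c"
    by (simp add: expansion_def a_def b_def c_def P_def)
  \<comment> \<open>The right-hand side has the coefficients of the product of
    \<open>expansion p n k\<close> and \<open>E\<close> up to degree 3 in \<open>P\<close>: adding a
    term to each harmonic sum agrees with multiplying by the new factor.\<close>
  have F': "expansion p n (Suc k) = 1 - P * (a + d) + P^2 * (b + a * d + e)
      - P^3 * (c + b * d + a * e + f)"
  proof -
    have "((a + d)^2 - n * (hsum 2 k + d^2)) / 2 = b + a * d + e"
      unfolding b_def e_def by (simp add: field_simps power2_eq_square)
    moreover have "(a + d)^3 / 6 - n * (a + d) * (hsum 2 k + d^2) / 2 + n^2 * (hsum 3 k + d^3) / 3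
        = c + b * d + a * e + f"
      unfolding b_def e_def c_def f_def by (simp add: field_simps power2_eq_square power3_eq_cube)
    ultimately show ?thesis
      by (simp add: expansion_def hsum_Suc P_def a_def d_def)
  qed
  \<comment> \<open>The terms of degree 4, 5 and 6 in \<open>P\<close> of the product of the two
    cubics, divided by \<open>P ^ 4\<close>.\<close>
  define w where "w = a * f + b * e + c * d - P * (b * f + c * e) + P^2 * (c * f)"
  have FE: "expansion p n k * E = expansion p n (Suc k) + P^4 * w"
    unfolding F F' E_def w_def by algebra
  have "(-1) ^ (Suc k * m) * ((of_nat p / of_nat m - 1 :: rat) gchoose Suc k) ^ m
     = (expansion p n k + P^4 * q) * (1 - P * n * d) ^ m"
    unfolding gbinomial_power_Suc eq by (simp add: P_def n_def d_def)
  also have "\<dots> = expansion p n (Suc k) + P^4 * (w + expansion p n k * v + q * (E + P^4 * v))"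
    unfolding Eeq using FE by algebra
  finally have "(-1) ^ (Suc k * m) * ((of_nat p / of_nat m - 1 :: rat) gchoose Suc k) ^ m
     = expansion p n (Suc k) + P^4 * (w + expansion p n k * v + q * (E + P^4 * v))" .
  moreover have "p_integral p (w + expansion p n k * v + q * (E + P^4 * v))"
    unfolding w_def E_def F using P a d v q bcef by (intro p_integral_intros) auto
  ultimately show ?case unfolding n_def P_def by blast
qed

section \<open>Wolstenholme's congruences for the full harmonic sums\<close>

lemma reciprocal_cong:
  assumes "\<not> p dvd i" "\<not> p dvd j" "int p dvd int i - int j"
  shows "1 / of_nat i - 1 / of_nat j \<in> p_pow_ideal p 1"
proof -
  obtain t where t: "int i - int j = int p * t" using assms(3) by (elim dvdE)
  have "(of_nat i :: rat) - of_nat j = of_int (int i - int j)" by simp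
  also have "\<dots> = of_nat p * of_int t" unfolding t by simp
  finally have ij: "(of_nat i :: rat) - of_nat j = of_nat p * of_int t" .
  have nz: "i \<noteq> 0" "j \<noteq> 0" using assms(1,2) by (metis dvd_0_right)+
  have "1 / x - 1 / y = - ((x - y) * (1 / x) * (1 / y))" if "x \<noteq> 0" "y \<noteq> 0" for x y :: rat
    using that by (simp add: field_simps)
  moreover have "(of_nat i :: rat) \<noteq> 0" "(of_nat j :: rat) \<noteq> 0" using nz by simp_all
  ultimately have "1 / of_nat i - 1 / of_nat j
      = - ((of_nat i - of_nat j) * (1 / of_nat i) * (1 / of_nat j) :: rat)" by blast
  also have "\<dots> = of_nat p ^ 1 * (- (of_int t * (1 / of_nat i) * (1 / of_nat j)))"
    unfolding ij by simp
  finally show ?thesis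
    by (rule p_pow_idealI[rotated])
      (intro p_integral_intros p_integral_of_int p_integral_inverse_of_nat p assms)
qed

text \<open>Doubling permutes the nonzero residues modulo \<open>p\<close>, so the sum is congruent
  to a quarter of itself. Hence three times the sum is divisible by \<open>p\<close>, and 3 is a
  unit because p > 3.\<close>

lemma hsum_2_ideal: "hsum 2 (p - 1) \<in> p_pow_ideal p 1"
proof -
  let ?A = "{1..p-1}" and ?g = "\<lambda>j. (2 * j) mod p"
  have cop: "coprime 2 p" using p p3 by (simp add: prime_odd_nat)
  have ndvd: "\<not> p dvd j" if "j \<in> ?A" for j using that by (auto dest: dvd_imp_le)
  have ndvd2: "\<not> p dvd 2 * j" if "j \<in> ?A" for j
    using ndvd[OF that] p p3 by (auto simp: prime_dvd_mult_iff dest: dvd_imp_le)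
  have inj: "inj_on ?g ?A"
  proof (rule inj_onI)
    fix i j assume ij: "i \<in> ?A" "j \<in> ?A" "?g i = ?g j"
    then have "int p dvd int (2 * i) - int (2 * j)"
      by (metis mod_eq_dvd_iff of_nat_mod)
    then have "int p dvd 2 * (int i - int j)" by (simp add: algebra_simps)
    moreover have "coprime (int p) 2" using cop by (metis coprime_commute coprime_int_iff of_nat_numeral)
    ultimately have "int p dvd int i - int j" by (metis coprime_dvd_mult_right_iff)
    moreover have "\<bar>int i - int j\<bar> < int p" using ij by auto
    ultimately have "int i - int j = 0" using dvd_imp_le_int[of "int i - int j" "int p"] by linarith
    then show "i = j" by simp
  qed
  have img: "?g ` ?A = ?A"
  proof (rule card_subset_eq)
    show "?g ` ?A \<subseteq> ?A"
    proof
      fix x assume "x \<in> ?g ` ?A"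
      then obtain j where j: "j \<in> ?A" "x = ?g j" by auto
      have "x \<noteq> 0" using ndvd2[OF j(1)] j(2) by (simp add: dvd_eq_mod_eq_0)
      moreover have "x < p" using j(2) p3 by simp
      ultimately show "x \<in> ?A" by auto
    qed
    show "card (?g ` ?A) = card ?A" using inj by (rule card_image)
  qed simp
  have "hsum 2 (p - 1) = (\<Sum>j\<in>?A. (1 / of_nat (?g j)) ^ 2)"
    unfolding hsum_def using sum.reindex[OF inj, of "\<lambda>j. (1 / of_nat j) ^ 2 :: rat"]
    by (simp only: img o_def)
  moreover have "hsum 2 (p - 1) = (\<Sum>j\<in>?A. 4 * (1 / of_nat (2 * j)) ^ 2)"
    unfolding hsum_def by (intro sum.cong) (auto simp: power2_eq_square)
  \<comment> \<open>Four times the sum permuted by doubling, minus the sum with each term rewritten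
    exactly through 2j.\<close>
  ultimately have "3 * hsum 2 (p - 1)
      = (\<Sum>j\<in>?A. 4 * ((1 / of_nat (?g j)) ^ 2 - (1 / of_nat (2 * j)) ^ 2))"
    by (simp add: sum_subtractf right_diff_distrib flip: sum_distrib_left)
  also have "\<dots> \<in> p_pow_ideal p 1"
  proof (rule p_pow_ideal_sum)
    fix j assume j: "j \<in> ?A"
    have g: "\<not> p dvd ?g j" using ndvd2[OF j] by (simp add: dvd_mod_iff)
    have "int p dvd int (?g j) - int (2 * j)" by (metis mod_eq_dvd_iff mod_mod_trivial of_nat_mod)
    then have "1 / of_nat (?g j) - 1 / of_nat (2 * j) \<in> p_pow_ideal p 1"
      using reciprocal_cong g ndvd2[OF j] by blast
    moreover have "p_integral p (4 * (1 / of_nat (?g j) + 1 / of_nat (2 * j)))"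
      by (intro p_integral_intros p_integral_inverse_of_nat p g ndvd2 j) simp
    ultimately have "(4 * (1 / of_nat (?g j) + 1 / of_nat (2 * j))) *
        (1 / of_nat (?g j) - 1 / of_nat (2 * j)) \<in> p_pow_ideal p 1"
      by (rule p_pow_ideal_mult_left[rotated])
    then show "4 * ((1 / of_nat (?g j)) ^ 2 - (1 / of_nat (2 * j)) ^ 2) \<in> p_pow_ideal p 1"
      by (simp only: power2_eq_square square_diff_square_factored mult.assoc)
  qed
  finally have "of_nat 3 * hsum 2 (p - 1) \<in> p_pow_ideal p 1" by simp
  then show ?thesis by (rule p_pow_ideal_cancel[OF p, rotated]) (use p3 in \<open>auto dest: dvd_imp_le\<close>)
qed

text \<open>Over the common denominator the numerators add up to \<open>p\<close>. The exact
  cofactor is recorded because \<open>wolstenholme\<close> must extract a second factor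
  \<open>p\<close> from it.\<close>

lemma reciprocal_reflect_eq:
  assumes "j \<in> {1..p-1}"
  shows "(1 / of_nat (p - j) + 1 / of_nat j :: rat) = of_nat p * ((1 / of_nat (p - j)) * (1 / of_nat j))"
proof -
  have nz: "p - j \<noteq> 0" "j \<noteq> 0" and "p = (p - j) + j" using assms by auto
  then have P: "(of_nat p :: rat) = of_nat (p - j) + of_nat j" by (metis of_nat_add)
  have "1 / x + 1 / y = (x + y) * ((1 / x) * (1 / y))" if "x \<noteq> 0" "y \<noteq> 0" for x y :: rat
    using that by (simp add: field_simps)
  moreover have "(of_nat (p - j) :: rat) \<noteq> 0" "(of_nat j :: rat) \<noteq> 0"
    using nz by (simp_all only: of_nat_eq_0_iff not_False_eq_True)
  ultimately have "(1 / of_nat (p - j) + 1 / of_nat j :: rat)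
      = (of_nat (p - j) + of_nat j) * ((1 / of_nat (p - j)) * (1 / of_nat j))" by blast
  then show ?thesis using P by (simp only:)
qed

lemma reciprocal_reflect:
  assumes "j \<in> {1..p-1}"
  shows "1 / of_nat (p - j) + 1 / of_nat j \<in> p_pow_ideal p 1"
proof (rule p_pow_idealI)
  show "p_integral p ((1 / of_nat (p - j)) * (1 / of_nat j))"
    using assms by (intro p_integral_mult p_integral_reciprocal) auto
qed (simp only: reciprocal_reflect_eq[OF assms] power_one_right)

text \<open>Pairing j with p - j makes twice the sum equal to \<open>p\<close> times the sum of
  1/(j(p - j)). Modulo \<open>p\<close> that cofactor is minus the sum of the 1/j^2, which is again
  divisible by \<open>p\<close>.\<close>

lemma wolstenholme: "hsum 1 (p - 1) \<in> p_pow_ideal p 2"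
proof -
  let ?A = "{1..p-1}"
  have rev: "(\<Sum>j\<in>?A. (1 / of_nat (p - j) :: rat)) = (\<Sum>j\<in>?A. 1 / of_nat j)"
    by (rule sum.reindex_bij_witness[of _ "\<lambda>j. p - j" "\<lambda>j. p - j"]) auto
  have "2 * hsum 1 (p - 1) = (\<Sum>j\<in>?A. 1 / of_nat (p - j) + 1 / of_nat j)"
    unfolding hsum_def sum.distrib rev by simp
  \<comment> \<open>With u = 1/(p - j) and v = 1/j this is uv = (u + v)v - v^2, where u + v is
    divisible by \<open>p\<close>.\<close>
  also have "\<dots> = (\<Sum>j\<in>?A. of_nat p * ((1 / of_nat (p - j) + 1 / of_nat j) * (1 / of_nat j) - (1 / of_nat j)^2))"
  proof (rule sum.cong)
    fix j assume j: "j \<in> ?A"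
    show "1 / of_nat (p - j) + 1 / of_nat j =
      (of_nat p * ((1 / of_nat (p - j) + 1 / of_nat j) * (1 / of_nat j) - (1 / of_nat j)^2) :: rat)"
      unfolding reciprocal_reflect_eq[OF j, symmetric]
      by (subst reciprocal_reflect_eq[OF j]) (simp only: power2_eq_square distrib_right add_diff_cancel_right')
  qed simp
  also have "\<dots> = of_nat p ^ 1 * ((\<Sum>j\<in>?A. (1 / of_nat j) * (1 / of_nat (p - j) + 1 / of_nat j)) - hsum 2 (p - 1))"
    unfolding hsum_def by (simp only: sum_distrib_left[symmetric] sum_subtractf power_one_right mult.commute)
  also have "\<dots> \<in> p_pow_ideal p (1 + 1)"
    by (intro p_pow_ideal_power_mult p_pow_ideal_diff hsum_2_ideal p_pow_ideal_sum p_pow_ideal_mult_left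
        reciprocal_reflect p_integral_reciprocal) auto
  finally have "of_nat 2 * hsum 1 (p - 1) \<in> p_pow_ideal p 2" by (simp add: numeral_2_eq_2)
  then show ?thesis by (rule p_pow_ideal_cancel[OF p, rotated]) (use p3 in \<open>auto dest: dvd_imp_le\<close>)
qed

lemma p_pow_ideal_mono:
  assumes "x \<in> p_pow_ideal p (s + r)" shows "x \<in> p_pow_ideal p r"
proof -
  obtain y where "p_integral p y" "x = of_nat p ^ (s + r) * y" using assms by (rule p_pow_idealE)
  then show ?thesis
    by (intro p_pow_idealI[of _ "of_nat p ^ s * y"]) (auto simp: power_add intro!: p_integral_intros)
qed

section \<open>Reflection of harmonic sums under k -> p - 1 - k, and their sums over k\<close>

lemma hsum_1_reflect: "k \<le> p - 1 \<Longrightarrow> hsum 1 (p - 1 - k) - hsum 1 k \<in> p_pow_ideal p 1"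
proof (induction k)
  case 0
  show ?case using p_pow_ideal_mono[of _ 1 1] wolstenholme by (simp add: numeral_2_eq_2)
next
  case (Suc k)
  have "p - 1 - k = Suc (p - 1 - Suc k)" "Suc (p - 1 - Suc k) = p - Suc k" using Suc.prems by simp_all
  \<comment> \<open>One upper limit falls while the other rises; the two terms involved are opposite
    modulo \<open>p\<close>.\<close>
  then have "hsum 1 (p - 1 - Suc k) - hsum 1 (Suc k) = (hsum 1 (p - 1 - k) - hsum 1 k)
     - (1 / of_nat (p - Suc k) + 1 / of_nat (Suc k))" by (simp add: hsum_Suc del: of_nat_Suc)
  then show ?case using Suc reciprocal_reflect[of "Suc k"] by (auto intro: p_pow_ideal_diff)
qed

text \<open>Squaring makes the reflected terms congruent rather than opposite, so here the sum of
  the two harmonic sums is preserved, starting from \<open>hsum_2_ideal\<close>.\<close>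

lemma hsum_2_reflect: "k \<le> p - 1 \<Longrightarrow> hsum 2 (p - 1 - k) + hsum 2 k \<in> p_pow_ideal p 1"
proof (induction k)
  case 0
  show ?case using hsum_2_ideal by simp
next
  case (Suc k)
  let ?a = "1 / of_nat (p - Suc k) :: rat" and ?b = "1 / of_nat (Suc k) :: rat"
  have "p - 1 - k = Suc (p - 1 - Suc k)" "Suc (p - 1 - Suc k) = p - Suc k" using Suc.prems by simp_all
  then have "hsum 2 (p - 1 - Suc k) + hsum 2 (Suc k) = (hsum 2 (p - 1 - k) + hsum 2 k)
     - (?a - ?b) * (?a + ?b)"
    by (simp add: hsum_Suc power2_eq_square algebra_simps del: of_nat_Suc)
  moreover have "(?a - ?b) * (?a + ?b) \<in> p_pow_ideal p 1"
    using Suc.prems reciprocal_reflect[of "Suc k"]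
    by (intro p_pow_ideal_mult_left p_integral_diff p_integral_reciprocal) auto
  ultimately show ?case using Suc by (auto intro: p_pow_ideal_diff)
qed

text \<open>In the double sum, 1/j^(s+1) occurs K + 1 - j times, which gives (K + 1)/j^(s+1) -
  1/j^s. At K = p - 1 the leading factor is \<open>p\<close>.\<close>

lemma sum_hsum: "(\<Sum>k=0..K. hsum (Suc s) k) = of_nat (Suc K) * hsum (Suc s) K - hsum s K"
proof (induction K)
  case (Suc K)
  have "(1 / of_nat (Suc K) :: rat) ^ s = of_nat (Suc K) * (1 / of_nat (Suc K)) ^ Suc s"
    by (simp del: of_nat_Suc)
  then have "hsum s (Suc K) = hsum s K + of_nat (Suc K) * (1 / of_nat (Suc K)) ^ Suc s"
    by (simp only: hsum_Suc)
  moreover have "u * H - h + (H + t) = (1 + u) * (H + t) - (h + u * t)" for u H h t :: rat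
    by (simp add: algebra_simps)
  ultimately show ?case using Suc
    by (simp only: hsum_Suc sum.atLeast0_atMost_Suc of_nat_Suc[of "Suc K"])
qed simp

text \<open>This sum carries only \<open>p ^ 2\<close> in the expansion, so it must supply two
  factors of \<open>p\<close>; Wolstenholme's congruence modulo \<open>p ^ 2\<close> is used in full
  here.\<close>

lemma sum_hsum_2: "(\<Sum>k=0..p-1. hsum 2 k) \<in> p_pow_ideal p 2"
proof -
  have "(\<Sum>k=0..p-1. hsum 2 k) = of_nat p ^ 1 * hsum 2 (p - 1) - hsum 1 (p - 1)"
    using sum_hsum[of 1 "p - 1"] p3 by (simp add: numeral_2_eq_2)
  moreover have "of_nat p ^ 1 * hsum 2 (p - 1) \<in> p_pow_ideal p (1 + 1)"
    by (intro p_pow_ideal_power_mult hsum_2_ideal)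
  ultimately show ?thesis using wolstenholme
    by (simp add: numeral_2_eq_2 p_pow_ideal_diff)
qed

lemma sum_hsum_3: "(\<Sum>k=0..p-1. hsum 3 k) \<in> p_pow_ideal p 1"
proof -
  have "(\<Sum>k=0..p-1. hsum 3 k) = of_nat p ^ 1 * hsum 3 (p - 1) - hsum 2 (p - 1)"
    using sum_hsum[of 2 "p - 1"] p3 by (simp add: numeral_3_eq_3 numeral_2_eq_2)
  moreover have "of_nat p ^ 1 * hsum 3 (p - 1) \<in> p_pow_ideal p 1"
    using p3 by (intro p_pow_idealI[OF p_integral_hsum]) auto
  ultimately show ?thesis using hsum_2_ideal by (simp add: p_pow_ideal_diff)
qed

lemma sum_hsum_1_2: "(\<Sum>k=0..p-1. hsum 1 k * hsum 2 k) \<in> p_pow_ideal p 1"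
proof -
  have "(\<Sum>k=0..p-1. hsum 1 (p-1-k) * hsum 2 (p-1-k)) = (\<Sum>k=0..p-1. hsum 1 k * hsum 2 k)"
    by (rule sum.reindex_bij_witness[of _ "\<lambda>j. p-1-j" "\<lambda>j. p-1-j"]) auto
  then have "2 * (\<Sum>k=0..p-1. hsum 1 k * hsum 2 k)
      = (\<Sum>k=0..p-1. hsum 1 (p-1-k) * hsum 2 (p-1-k) + hsum 1 k * hsum 2 k)"
    by (simp add: sum.distrib)
  \<comment> \<open>With a' and b' for the reflected values, a'b' + ab = a(b' + b) + b'(a' - a), and
    both brackets vanish modulo \<open>p\<close>.\<close>
  also have "\<dots> = (\<Sum>k=0..p-1. hsum 1 k * (hsum 2 (p-1-k) + hsum 2 k)
      + hsum 2 (p-1-k) * (hsum 1 (p-1-k) - hsum 1 k))"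
    by (intro sum.cong) (auto simp: algebra_simps)
  also have "\<dots> \<in> p_pow_ideal p 1"
    using p3 by (intro p_pow_ideal_sum p_pow_ideal_add p_pow_ideal_mult_left p_integral_hsum
        hsum_1_reflect hsum_2_reflect) auto
  finally have "of_nat 2 * (\<Sum>k=0..p-1. hsum 1 k * hsum 2 k) \<in> p_pow_ideal p 1" by simp
  then show ?thesis by (rule p_pow_ideal_cancel[OF p, rotated]) (use p3 in \<open>auto dest: dvd_imp_le\<close>)
qed

section \<open>Independence of m modulo \<open>p ^ 4\<close>, and the conclusion\<close>

lemma sum_expansion_independent:
  assumes n: "p_integral p n" and n': "p_integral p n'"
  shows "(\<Sum>k=0..p-1. expansion p n k) - (\<Sum>k=0..p-1. expansion p n' k) \<in> p_pow_ideal p 4"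
proof -
  let ?S2 = "\<Sum>k=0..p-1. hsum 2 k" and ?S3 = "\<Sum>k=0..p-1. hsum 3 k"
    and ?S12 = "\<Sum>k=0..p-1. hsum 1 k * hsum 2 k"
  \<comment> \<open>The pure powers of \<open>hsum 1 k\<close> carry no \<open>n\<close> and cancel,
    so their sums over \<open>k\<close> never have to be evaluated.\<close>
  have "expansion p n k - expansion p n' k = ((n' - n) * (1/2)) * (of_nat p ^ 2 * hsum 2 k)
     - ((n' - n) * (1/2)) * (of_nat p ^ 3 * (hsum 1 k * hsum 2 k))
     + ((n'^2 - n^2) * (1/3)) * (of_nat p ^ 3 * hsum 3 k)" for k
    unfolding expansion_def by (simp add: field_simps)
  then have "(\<Sum>k=0..p-1. expansion p n k) - (\<Sum>k=0..p-1. expansion p n' k)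
     = ((n' - n) * (1/2)) * (of_nat p ^ 2 * ?S2) - ((n' - n) * (1/2)) * (of_nat p ^ 3 * ?S12)
     + ((n'^2 - n^2) * (1/3)) * (of_nat p ^ 3 * ?S3)"
    by (simp only: sum_subtractf[symmetric]) (simp only: sum.distrib sum_subtractf sum_distrib_left)
  moreover have "of_nat p ^ 2 * ?S2 \<in> p_pow_ideal p 4"
    using p_pow_ideal_power_mult[OF sum_hsum_2, of 2] by simp
  moreover have "of_nat p ^ 3 * ?S12 \<in> p_pow_ideal p 4" "of_nat p ^ 3 * ?S3 \<in> p_pow_ideal p 4"
    using p_pow_ideal_power_mult[OF sum_hsum_1_2, of 3] p_pow_ideal_power_mult[OF sum_hsum_3, of 3]
    by simp_all
  moreover have "p_integral p ((n' - n) * (1/2))" "p_integral p ((n'^2 - n^2) * (1/3))"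
    by (intro p_integral_intros n n' p_integral_half p_integral_third)+
  ultimately show ?thesis
    by (simp only: p_pow_ideal_add p_pow_ideal_diff p_pow_ideal_mult_left)
qed

lemma sum_minus_expansion:
  assumes m: "m > 0" "\<not> p dvd m"
  shows "(\<Sum>k=0..p-1. (-1) ^ (k * m) * ((of_nat p / of_nat m - 1 :: rat) gchoose k) ^ m)
     - (\<Sum>k=0..p-1. expansion p (1 / of_nat m) k) \<in> p_pow_ideal p 4"
  unfolding sum_subtractf[symmetric]
proof (rule p_pow_ideal_sum)
  fix k assume "k \<in> {0..p-1}"
  then have "k < p" using p3 by auto
  then show "(-1) ^ (k * m) * ((of_nat p / of_nat m - 1 :: rat) gchoose k) ^ m
     - expansion p (1 / of_nat m) k \<in> p_pow_ideal p 4"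
    using term_expansion[OF m] by (metis add_diff_cancel_left' p_pow_idealI)
qed

lemma sum_gbinomial_ideal:
  assumes m: "m > 0" "\<not> p dvd m"
  shows "(\<Sum>k=0..p-1. (-1) ^ (k * m) * ((of_nat p / of_nat m - 1 :: rat) gchoose k) ^ m)
    \<in> p_pow_ideal p 4"
proof -
  have eq: "(of_nat p - 1 :: rat) = of_nat (p - 1)" using p3 by (simp add: of_nat_diff)
  have "(\<Sum>k=0..p-1. (-1) ^ (k * 1) * ((of_nat p / of_nat 1 - 1 :: rat) gchoose k) ^ 1)
      = (\<Sum>k\<le>p-1. (-1) ^ k * of_nat ((p - 1) choose k))"
    by (simp add: eq binomial_gbinomial atLeast0AtMost del: of_nat_diff)
  also have "\<dots> = 0" using p3 by (intro choose_alternating_sum) auto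
  finally have E1: "(\<Sum>k=0..p-1. expansion p 1 k) \<in> p_pow_ideal p 4"
    using sum_minus_expansion[of 1] p_pow_ideal_diff[OF p_pow_ideal_zero] p3 p_pow_ideal_diff
    by fastforce
  \<comment> \<open>A telescoping sum: the given sum minus the expansion at 1/m, that expansion
    minus the one at 1, and the expansion at 1.\<close>
  show ?thesis
    using p_pow_ideal_add[OF sum_minus_expansion[OF m] p_pow_ideal_add[OF
      sum_expansion_independent[OF p_integral_inverse_of_nat[OF p m(2)] p_integral_numeral(2)] E1]]
    by simp
qed

end

lemma rat_cong_0I:
  assumes "p > 0" "x \<in> p_pow_ideal p r"
  shows "rat_cong p r x 0"
proof -
  obtain y where "p_integral p y" "x = of_nat p ^ r * y" using assms(2) by (rule p_pow_idealE)
  then show ?thesis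
    using assms(1) unfolding rat_cong_def by (auto intro!: p_integral_intros)
qed

theorem theorem1p2:
  fixes p :: nat
  assumes "prime p" and "p > 3"
  shows "(\<forall>m::nat. m > 0 \<and> \<not> p dvd m \<longrightarrow>
           rat_cong p 4
             (\<Sum>k=0..p-1. (-1) ^ (k * m) * ((of_nat p / of_nat m - 1 :: rat) gchoose k) ^ m) 0) \<and>
         rat_cong p 4 (\<Sum>k=0..p-1. ((1 / (of_nat p - 1) :: rat) gchoose k) ^ (p - 1)) 0"
proof
  show main: "\<forall>m::nat. m > 0 \<and> \<not> p dvd m \<longrightarrow>
           rat_cong p 4
             (\<Sum>k=0..p-1. (-1) ^ (k * m) * ((of_nat p / of_nat m - 1 :: rat) gchoose k) ^ m) 0"
    using assms sum_gbinomial_ideal by (auto intro: rat_cong_0I)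
  have ndvd: "p - 1 > 0" "\<not> p dvd p - 1" using assms by (auto dest: dvd_imp_le)
  \<comment> \<open>As \<open>p\<close> is odd, all signs disappear when m = p - 1.\<close>
  have "even (p - 1)" using assms prime_odd_nat by simp
  then have sgn: "(-1 :: rat) ^ (k * (p - 1)) = 1" for k by simp
  have arg: "(of_nat p / of_nat (p - 1) - 1 :: rat) = 1 / (of_nat p - 1)"
    using assms by (simp add: of_nat_diff field_simps)
  show "rat_cong p 4 (\<Sum>k=0..p-1. ((1 / (of_nat p - 1) :: rat) gchoose k) ^ (p - 1)) 0"
    using main[rule_format, OF conjI[OF ndvd]] unfolding sgn arg by simp
qed

end
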